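(* Let $d\ge 3$ be an integer and let $p_b$ be a real number with $p_b>2$ and $d-1\le p_b<d$. For every $\alpha>0$ and every $\rho_b\in(0,1)$ there exists a (time-independent) Borel function $b:\mathbb{R}^d\to\mathbb{R}^d$ such that $$ \Big(\frac{1}{\mathrm{Vol}(B)}\int_B|b(x)|^{p_b}\,dx\Big)^{1/p_b}\le\alpha\,\rho^{-1} $$ for all $\rho\in(0,\rho_b]$ and all balls $B\subset\mathbb{R}^d$ of radius $\rho$, but $b\notin L_{p_b+\varepsilon,\mathrm{loc}}(\mathbb{R}^d)$ for every $\varepsilon>0$.
   Context: $\mathrm{Vol}(B)$ is the Lebesgue measure of $B$. $L_{p,\mathrm{loc}}(\mathbb{R}^d)$ denotes the set of Borel functions $b$ such that $\int_K|b|^p\,dx<\infty$ for every compact $K\subset\mathbb{R}^d$. *)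

theory Defs
  imports "HOL-Analysis.Analysis"
begin

definition Lp_loc :: "real \<Rightarrow> ('a::euclidean_space \<Rightarrow> 'b::euclidean_space) set" where
  "Lp_loc p = {b. b \<in> borel_measurable borel \<and>
     (\<forall>K. compact K \<longrightarrow> (\<integral>\<^sup>+x\<in>K. ennreal (norm (b x) powr p) \<partial>lborel) < \<infinity>)}"

text \<open>The Bochner integral of a non-integrable function is 0 by convention, so an upper bound
  on the mean is only meaningful together with integrability; the predicate below asks for both.\<close>

definition Lp_mean_le :: "real \<Rightarrow> ('a::euclidean_space \<Rightarrow> 'b::euclidean_space) \<Rightarrow> 'a set \<Rightarrow> real \<Rightarrow> bool" where
  "Lp_mean_le p b B c \<longleftrightarrow>
     set_integrable lborel B (\<lambda>x. norm (b x) powr p) \<and>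
     (1 / measure lborel B * (LINT x:B|lborel. norm (b x) powr p)) powr (1 / p) \<le> c"

end

theory Submission
  imports Defs "HOL-Real_Asymp.Real_Asymp"
begin

text \<open>The field points in a fixed direction \<open>e\<close> and depends only on \<open>x \<bullet> e\<close>: let
  \<open>|b|\<^sup>p = c g(x \<bullet> e)\<close> with \<open>g(t) = 1 / (t ln\<^sup>2 t)\<close> near \<open>0+\<close>, which is integrable
  although no power \<open>g\<^sup>q\<close> with \<open>q > 1\<close> is. A ball of radius \<open>\<rho>\<close> lies in a cube of side
  \<open>2\<rho>\<close>, so the mean of \<open>|b|\<^sup>p\<close> over it is at most a constant times \<open>c / \<rho>\<close>; as \<open>\<rho> < 1 \<le> p\<close>,
  this is at most \<open>\<alpha>\<^sup>p \<rho>\<^sup>-\<^sup>p\<close> once \<open>c\<close> is small.\<close>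

text \<open>The cutoff at 1/2 excludes t = 1, where \<open>ln t\<close> vanishes, so 0 is the only
  singularity; it also puts the support inside the unit interval.\<close>

definition log_spike :: "real \<Rightarrow> real" where
  "log_spike t = indicator {0<..<1/2} t * (1 / (t * (ln t)\<^sup>2))"

lemma log_spike_measurable [measurable]: "log_spike \<in> borel_measurable borel"
  unfolding log_spike_def by measurable

lemma log_spike_nonneg: "log_spike t \<ge> 0"
  by (auto simp: log_spike_def indicator_def)

text \<open>On (0, 1/2) an antiderivative is -1 / ln t, with finite limits 0 at the left end and 1 /
  ln 2 at the right end. As the integrand is nonnegative, the fundamental theorem on the open
  interval yields integrability.\<close>

lemma integrable_log_spike: "integrable lborel log_spike"
proof -
  have "set_integrable lborel (einterval 0 (ereal (1/2))) (\<lambda>t. 1 / (t * (ln t)\<^sup>2))"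
  proof (rule interval_integral_FTC_nonneg(1))
    fix t :: real assume t: "0 < ereal t" "ereal t < ereal (1/2)"
    then have "0 < t" "t < 1/2" by auto
    then have "ln t \<noteq> 0" by simp
    show "((\<lambda>t. - 1 / ln t) has_real_derivative 1 / (t * (ln t)\<^sup>2)) (at t)"
      using \<open>0 < t\<close> \<open>ln t \<noteq> 0\<close>
      by (auto intro!: derivative_eq_intros simp: power2_eq_square field_simps)
    show "isCont (\<lambda>t. 1 / (t * (ln t)\<^sup>2)) t"
      using \<open>0 < t\<close> \<open>ln t \<noteq> 0\<close> by (auto intro!: continuous_intros)
  next
    have "((\<lambda>t::real. - 1 / ln t) \<longlongrightarrow> 0) (at_right 0)" by real_asymp
    then show "(((\<lambda>t. - 1 / ln t) \<circ> real_of_ereal) \<longlongrightarrow> 0) (at_right 0)"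
      by (simp add: zero_ereal_def ereal_tendsto_simps)
    have "((\<lambda>t::real. - 1 / ln t) \<longlongrightarrow> - 1 / ln (1/2)) (at_left (1/2))"
      by (intro tendsto_intros) auto
    then show "(((\<lambda>t. - 1 / ln t) \<circ> real_of_ereal) \<longlongrightarrow> - 1 / ln (1/2)) (at_left (ereal (1/2)))"
      by (simp only: ereal_tendsto_simps)
  qed (auto intro!: AE_I2)
  moreover have "einterval 0 (ereal (1/2)) = {0<..<1/2}"
    by (auto simp: einterval_def)
  ultimately show ?thesis
    by (simp add: set_integrable_def log_spike_def[abs_def])
qed

lemma nn_integral_inverse_at_0:
  fixes \<delta> :: real
  assumes "\<delta> > 0"
  shows "(\<integral>\<^sup>+t. ennreal (1 / t) * indicator {0<..<\<delta>} t \<partial>lborel) = \<infinity>"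
proof (rule ccontr)
  assume "\<not> ?thesis"
  then obtain M where M: "(\<integral>\<^sup>+t. ennreal (1 / t) * indicator {0<..<\<delta>} t \<partial>lborel) = ennreal M" "M \<ge> 0"
    by (metis ennreal_cases infinity_ennreal_def)
  \<comment> \<open>Chosen so that 1/t has integral exactly M + 1 over [\<eta>, \<delta>/2],
    exceeding the supposed total M. Halving \<delta> keeps this closed interval inside the open
    one.\<close>
  define \<eta> where "\<eta> = \<delta> / 2 * exp (- (M + 1))"
  have \<eta>: "0 < \<eta>" "\<eta> \<le> \<delta> / 2"
    using assms M(2) by (auto simp: \<eta>_def mult_le_cancel_left1)
  have "(\<integral>\<^sup>+t. ennreal (1 / t) * indicator {\<eta>..\<delta>/2} t \<partial>lborel) = ennreal (ln (\<delta> / 2) - ln \<eta>)"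
    using \<eta> by (intro nn_integral_FTC_Icc) (auto intro!: derivative_eq_intros)
  also have "ln (\<delta> / 2) - ln \<eta> = M + 1"
    unfolding \<eta>_def using assms by (subst ln_mult) auto
  finally have "ennreal (M + 1) = (\<integral>\<^sup>+t. ennreal (1 / t) * indicator {\<eta>..\<delta>/2} t \<partial>lborel)" ..
  also have "\<dots> \<le> (\<integral>\<^sup>+t. ennreal (1 / t) * indicator {0<..<\<delta>} t \<partial>lborel)"
    using \<eta> assms by (intro nn_integral_mono) (auto simp: indicator_def)
  finally show False
    using M by simp
qed

text \<open>As t tends to 0+, the factor t^(1-q) outgrows every power of |ln t|, so the integrand
  eventually dominates the non-integrable 1/t, whatever the value of c.\<close>

lemma nn_integral_log_spike_powr:
  assumes "c > 0" "q > 1"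
  shows "(\<integral>\<^sup>+t. ennreal ((c * log_spike t) powr q) \<partial>lborel) = \<infinity>"
proof -
  have "eventually (\<lambda>t. 1 / t \<le> (c * (1 / (t * (ln t)\<^sup>2))) powr q) (at_right 0)"
    using assms by real_asymp
  then obtain \<delta> where \<delta>: "\<delta> > 0" "\<And>t. 0 < t \<Longrightarrow> t < \<delta> \<Longrightarrow> 1 / t \<le> (c * (1 / (t * (ln t)\<^sup>2))) powr q"
    by (auto simp: eventually_at_right_field)
  \<comment> \<open>Below 1/2 the indicator in \<open>log_spike\<close> equals 1, so there the
    asymptotic comparison applies to \<open>log_spike\<close> itself.\<close>
  define \<delta>' where "\<delta>' = min \<delta> (1/2)"
  have "\<infinity> = (\<integral>\<^sup>+t. ennreal (1 / t) * indicator {0<..<\<delta>'} t \<partial>lborel)"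
    using \<delta>(1) by (intro nn_integral_inverse_at_0[symmetric]) (simp add: \<delta>'_def)
  also have "\<dots> \<le> (\<integral>\<^sup>+t. ennreal ((c * log_spike t) powr q) \<partial>lborel)"
    using \<delta> by (intro nn_integral_mono)
      (auto simp: log_spike_def \<delta>'_def indicator_def simp del: times_divide_eq_right intro!: ennreal_leI)
  finally show ?thesis by (simp add: top_unique)
qed

text \<open>The integrand is a product of functions of single coordinates, so the integral
  factorises. Both the upper bound on balls and the divergence on the cube rest on this.\<close>

lemma nn_integral_coordinate_times_indicators:
  fixes e :: "'a::euclidean_space"
  assumes e: "e \<in> Basis" and [measurable]: "G \<in> borel_measurable borel"
    and [measurable]: "\<And>b. A b \<in> sets borel"
  shows "(\<integral>\<^sup>+x. G (x \<bullet> e) * (\<Prod>b\<in>Basis - {e}. indicator (A b) (x \<bullet> b)) \<partial>lborel) =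
    (\<integral>\<^sup>+t. G t \<partial>lborel) * (\<Prod>b\<in>Basis - {e}. emeasure lborel (A b))"
proof -
  define f where "f b = (if b = e then G else indicator (A b))" for b
  have "(\<integral>\<^sup>+x. (\<Prod>b\<in>Basis. f b (x \<bullet> b)) \<partial>lborel) = (\<Prod>b\<in>Basis. (\<integral>\<^sup>+t. f b t \<partial>lborel))"
    by (intro nn_integral_lborel_prod) (auto simp: f_def)
  then show ?thesis
    using e by (simp add: prod.remove[of Basis e] f_def)
qed

text \<open>Only the coordinates other than \<open>e\<close> are confined, each to an interval of
  length 2\<rho>; the \<open>e\<close>-coordinate runs over the whole line. Hence the bound is
  uniform in the centre \<open>x\<close> and has one power of \<rho> fewer than the volume.\<close>

lemma nn_integral_coordinate_ball_le:
  fixes e x :: "'a::euclidean_space"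
  assumes e: "e \<in> Basis" and [measurable]: "G \<in> borel_measurable borel" and "\<rho> \<ge> 0"
  shows "(\<integral>\<^sup>+y\<in>ball x \<rho>. G (y \<bullet> e) \<partial>lborel) \<le> (\<integral>\<^sup>+t. G t \<partial>lborel) * ennreal ((2 * \<rho>) ^ (DIM('a) - 1))"
proof -
  let ?A = "\<lambda>b. {x \<bullet> b - \<rho> .. x \<bullet> b + \<rho>}"
  have "(\<integral>\<^sup>+y\<in>ball x \<rho>. G (y \<bullet> e) \<partial>lborel) \<le>
      (\<integral>\<^sup>+y. G (y \<bullet> e) * (\<Prod>b\<in>Basis - {e}. indicator (?A b) (y \<bullet> b)) \<partial>lborel)"
  proof (intro nn_integral_mono mult_left_mono)
    fix y :: 'a
    show "indicator (ball x \<rho>) y \<le> (\<Prod>b\<in>Basis - {e}. indicator (?A b) (y \<bullet> b) :: ennreal)"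
    proof (cases "y \<in> ball x \<rho>")
      case True
      have "y \<bullet> b \<in> ?A b" if "b \<in> Basis" for b
        using Basis_le_norm[OF that, of "x - y"] True
        by (auto simp: dist_norm inner_diff_left)
      then show ?thesis by (simp add: indicator_def)
    qed simp
  qed simp
  also have "\<dots> = (\<integral>\<^sup>+t. G t \<partial>lborel) * (\<Prod>b\<in>Basis - {e}. emeasure lborel (?A b))"
    by (intro nn_integral_coordinate_times_indicators e) auto
  also have "(\<Prod>b\<in>Basis - {e}. emeasure lborel (?A b)) = ennreal ((2 * \<rho>) ^ (DIM('a) - 1))"
    using e \<open>\<rho> \<ge> 0\<close> by (simp add: ennreal_power card_Diff_singleton)
  finally show ?thesis .
qed

text \<open>Where \<open>G (x \<bullet> e)\<close> is nonzero, the \<open>e\<close>-coordinate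
  already lies in [0, 1], so membership in the cube is a condition on the other coordinates alone,
  and their sides have measure 1.\<close>

lemma nn_integral_coordinate_unit_cube:
  fixes e :: "'a::euclidean_space"
  assumes e: "e \<in> Basis" and [measurable]: "G \<in> borel_measurable borel"
    and G: "\<And>t. t \<notin> {0..1} \<Longrightarrow> G t = 0"
  shows "(\<integral>\<^sup>+x\<in>cbox 0 One. G (x \<bullet> e) \<partial>lborel) = (\<integral>\<^sup>+t. G t \<partial>lborel)"
proof -
  have "(\<integral>\<^sup>+x\<in>cbox 0 One. G (x \<bullet> e) \<partial>lborel) =
      (\<integral>\<^sup>+x. G (x \<bullet> e) * (\<Prod>b\<in>Basis - {e}. indicator {0..1} (x \<bullet> b)) \<partial>lborel)"
  proof (intro nn_integral_cong)
    fix x :: 'a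
    show "G (x \<bullet> e) * indicator (cbox 0 One) x =
        G (x \<bullet> e) * (\<Prod>b\<in>Basis - {e}. indicator {0..1} (x \<bullet> b))"
    proof (cases "x \<bullet> e \<in> {0..1}")
      case True
      then have "x \<in> cbox 0 One \<longleftrightarrow> (\<forall>b\<in>Basis - {e}. x \<bullet> b \<in> {0..1})"
        by (auto simp: mem_box)
      then have "indicator (cbox 0 One) x = (\<Prod>b\<in>Basis - {e}. indicator {0..1} (x \<bullet> b) :: ennreal)"
        by (auto simp: indicator_def intro!: prod_zero[symmetric])
      then show ?thesis by simp
    qed (simp add: G)
  qed
  also have "\<dots> = (\<integral>\<^sup>+t. G t \<partial>lborel) * (\<Prod>b\<in>Basis - {e}. emeasure lborel {0..1::real})"
    by (intro nn_integral_coordinate_times_indicators e) auto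
  finally show ?thesis by simp
qed

text \<open>One bound on the nonnegative integral serves both halves of \<open>Lp_mean_le\<close>:
  its finiteness gives integrability, and it carries over to the Bochner integral, after which p-th
  roots are taken.\<close>

lemma Lp_mean_leI:
  fixes b :: "'a::euclidean_space \<Rightarrow> 'b::euclidean_space"
  assumes [measurable]: "b \<in> borel_measurable borel" "B \<in> sets borel"
    and "p > 0" "c \<ge> 0" "measure lborel B > 0"
    and le: "(\<integral>\<^sup>+x\<in>B. ennreal (norm (b x) powr p) \<partial>lborel) \<le> ennreal (measure lborel B * c powr p)"
  shows "Lp_mean_le p b B c"
proof -
  define I where "I = (LINT x:B|lborel. norm (b x) powr p)"
  have "(\<integral>\<^sup>+x. ennreal (indicator B x *\<^sub>R norm (b x) powr p) \<partial>lborel) =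
      (\<integral>\<^sup>+x\<in>B. ennreal (norm (b x) powr p) \<partial>lborel)"
    by (intro nn_integral_cong) (auto simp: indicator_def)
  with le have le': "(\<integral>\<^sup>+x. ennreal (indicator B x *\<^sub>R norm (b x) powr p) \<partial>lborel) \<le>
      ennreal (measure lborel B * c powr p)"
    by simp
  have "set_integrable lborel B (\<lambda>x. norm (b x) powr p)"
    unfolding set_integrable_def
    by (rule integrableI_nonneg[OF _ _ le_less_trans[OF le']]) auto
  moreover have "I \<le> measure lborel B * c powr p"
    unfolding I_def set_lebesgue_integral_def
    by (rule integral_real_bounded[OF _ le']) simp
  then have "1 / measure lborel B * I \<le> c powr p"
    using assms(5) by (simp add: field_simps)
  moreover have "I \<ge> 0"
    unfolding I_def set_lebesgue_integral_def by (intro Bochner_Integration.integral_nonneg) auto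
  ultimately have "(1 / measure lborel B * I) powr (1 / p) \<le> (c powr p) powr (1 / p)"
    using assms(3) by (intro powr_mono2) auto
  also have "\<dots> = c"
    using assms(3,4) by (simp add: powr_powr)
  finally show ?thesis
    using \<open>set_integrable lborel B _\<close> by (simp add: Lp_mean_le_def I_def)
qed

theorem mainTheorem2:
  fixes p\<^sub>b :: real
  assumes "CARD('n::finite) \<ge> 3"
    and "p\<^sub>b > 2" and "real CARD('n) - 1 \<le> p\<^sub>b" and "p\<^sub>b < real CARD('n)"
  shows "\<forall>\<alpha>::real. \<forall>\<rho>\<^sub>b::real. \<alpha> > 0 \<longrightarrow> 0 < \<rho>\<^sub>b \<longrightarrow> \<rho>\<^sub>b < 1 \<longrightarrow>
    (\<exists>b :: real ^ 'n \<Rightarrow> real ^ 'n. b \<in> borel_measurable borel \<and>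
      (\<forall>\<rho> x. 0 < \<rho> \<longrightarrow> \<rho> \<le> \<rho>\<^sub>b \<longrightarrow> Lp_mean_le p\<^sub>b b (ball x \<rho>) (\<alpha> * inverse \<rho>)) \<and>
      (\<forall>\<epsilon>::real. \<epsilon> > 0 \<longrightarrow> b \<notin> Lp_loc (p\<^sub>b + \<epsilon>)))"
proof (intro allI impI)
  fix \<alpha> \<rho>\<^sub>b :: real
  assume \<alpha>: "\<alpha> > 0" and \<rho>\<^sub>b: "0 < \<rho>\<^sub>b" "\<rho>\<^sub>b < 1"
  have p: "p\<^sub>b > 0" "p\<^sub>b \<ge> 1" using assms(2) by auto
  obtain e :: "real ^ 'n" where e: "e \<in> Basis" using nonempty_Basis by blast
  define n where "n = DIM(real ^ 'n)"
  have n: "n = Suc (n - 1)" by (simp add: n_def)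
  define V where "V = unit_ball_vol (real n)"
  have V: "V > 0" by (simp add: V_def)
  define J where "J = (\<integral>t. log_spike t \<partial>lborel)"
  have J: "J \<ge> 0" by (simp add: J_def integral_nonneg log_spike_nonneg)
  \<comment> \<open>Solves \<open>c * (J + 1) * 2 ^ (n - 1) = V * \<alpha> powr p\<^sub>b\<close>,
    the bound required on balls. Using J + 1 keeps the denominator positive knowing only J \<ge>
    0.\<close>
  define c where "c = V * \<alpha> powr p\<^sub>b / (2 ^ (n - 1) * (J + 1))"
  have c: "c > 0" using V \<alpha> J by (simp add: c_def)
  have cJ: "c * J * 2 ^ (n - 1) \<le> V * \<alpha> powr p\<^sub>b"
  proof -
    have "c * J * 2 ^ (n - 1) \<le> c * (J + 1) * 2 ^ (n - 1)"
      using c by (intro mult_right_mono mult_left_mono) auto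
    also have "\<dots> = V * \<alpha> powr p\<^sub>b"
      using J by (simp add: c_def)
    finally show ?thesis .
  qed
  \<comment> \<open>Since \<open>e\<close> is a unit vector, the root makes |b|^q equal to the power
    q / \<open>p\<^sub>b\<close> of \<open>c * log_spike (x \<bullet> e)\<close>: integrable in the
    \<open>e\<close>-coordinate for q = \<open>p\<^sub>b\<close>, too singular for any larger
    q.\<close>
  define b where "b x = (c * log_spike (x \<bullet> e)) powr (1 / p\<^sub>b) *\<^sub>R e" for x
  have b_meas [measurable]: "b \<in> borel_measurable borel"
    unfolding b_def by measurable
  have norm_b: "norm (b x) powr q = (c * log_spike (x \<bullet> e)) powr (q / p\<^sub>b)" for x q
    using e by (simp add: b_def powr_powr)
  have mean: "Lp_mean_le p\<^sub>b b (ball x \<rho>) (\<alpha> * inverse \<rho>)" if \<rho>: "0 < \<rho>" "\<rho> \<le> \<rho>\<^sub>b" for \<rho> x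
  proof (rule Lp_mean_leI)
    have vol: "measure lborel (ball x \<rho>) = V * \<rho> ^ n"
      using \<rho> by (simp add: content_ball V_def n_def)
    then show "measure lborel (ball x \<rho>) > 0" using V \<rho> by simp
    have "(\<integral>\<^sup>+y\<in>ball x \<rho>. ennreal (norm (b y) powr p\<^sub>b) \<partial>lborel) =
        (\<integral>\<^sup>+y\<in>ball x \<rho>. ennreal (c * log_spike (y \<bullet> e)) \<partial>lborel)"
      using p c log_spike_nonneg by (simp add: norm_b)
    also have "\<dots> \<le> (\<integral>\<^sup>+t. ennreal (c * log_spike t) \<partial>lborel) * ennreal ((2 * \<rho>) ^ (n - 1))"
      unfolding n_def using \<rho> by (intro nn_integral_coordinate_ball_le[where G = "\<lambda>t. ennreal (c * log_spike t)"] e) auto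
    also have "(\<integral>\<^sup>+t. ennreal (c * log_spike t) \<partial>lborel) = ennreal (c * J)"
      unfolding J_def using c log_spike_nonneg integrable_log_spike
      by (subst nn_integral_eq_integral) auto
    also have "ennreal (c * J) * ennreal ((2 * \<rho>) ^ (n - 1)) = ennreal (c * J * 2 ^ (n - 1) * \<rho> ^ (n - 1))"
      using c J \<rho> by (subst ennreal_mult[symmetric]) (auto simp: power_mult_distrib mult_ac)
    also have "\<dots> \<le> ennreal (V * \<alpha> powr p\<^sub>b * (\<rho> ^ n * inverse \<rho> powr p\<^sub>b))"
    proof (rule ennreal_leI, rule mult_mono[OF cJ])
      \<comment> \<open>Here \<rho> < 1 and \<open>p\<^sub>b \<ge> 1\<close> enter: the single
        factor 1/\<rho> lost against the volume \<rho>^n is absorbed by the allowed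
        \<rho>^(-p).\<close>
      have "inverse \<rho> powr 1 \<le> inverse \<rho> powr p\<^sub>b"
        using \<rho> \<rho>\<^sub>b p by (intro powr_mono) (auto simp: field_simps)
      then have "\<rho> ^ n * inverse \<rho> \<le> \<rho> ^ n * inverse \<rho> powr p\<^sub>b"
        using \<rho> by (intro mult_left_mono) auto
      also have "\<rho> ^ n * inverse \<rho> = \<rho> ^ (n - 1)"
        using \<rho> by (subst n) simp
      finally show "\<rho> ^ (n - 1) \<le> \<rho> ^ n * inverse \<rho> powr p\<^sub>b" .
    qed (use V \<rho> in auto)
    also have "V * \<alpha> powr p\<^sub>b * (\<rho> ^ n * inverse \<rho> powr p\<^sub>b) =
        measure lborel (ball x \<rho>) * (\<alpha> * inverse \<rho>) powr p\<^sub>b"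
      using \<alpha> \<rho> by (simp add: vol powr_mult)
    finally show "(\<integral>\<^sup>+y\<in>ball x \<rho>. ennreal (norm (b y) powr p\<^sub>b) \<partial>lborel) \<le>
        ennreal (measure lborel (ball x \<rho>) * (\<alpha> * inverse \<rho>) powr p\<^sub>b)" .
  qed (use \<alpha> \<rho> p in auto)
  have "b \<notin> Lp_loc (p\<^sub>b + \<epsilon>)" if "\<epsilon> > 0" for \<epsilon> :: real
  proof -
    \<comment> \<open>The excess \<epsilon> becomes an exponent above 1 on the spike. The unit cube,
      whose boundary meets the singular hyperplane, is the compact set on which the integral
      diverges.\<close>
    define q where "q = (p\<^sub>b + \<epsilon>) / p\<^sub>b"
    have q: "q > 1" using p that by (simp add: q_def)
    have "(\<integral>\<^sup>+x\<in>cbox 0 One. ennreal (norm (b x) powr (p\<^sub>b + \<epsilon>)) \<partial>lborel) =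
        (\<integral>\<^sup>+x\<in>cbox 0 One. ennreal ((c * log_spike (x \<bullet> e)) powr q) \<partial>lborel)"
      by (simp add: norm_b q_def)
    also have "\<dots> = (\<integral>\<^sup>+t. ennreal ((c * log_spike t) powr q) \<partial>lborel)"
      by (intro nn_integral_coordinate_unit_cube[where G = "\<lambda>t. ennreal ((c * log_spike t) powr q)"] e)
        (auto simp: log_spike_def indicator_def)
    also have "\<dots> = \<infinity>"
      by (rule nn_integral_log_spike_powr[OF c q])
    finally show ?thesis
      by (auto simp: Lp_loc_def intro!: exI[of _ "cbox 0 One"])
  qed
  with b_meas mean show "\<exists>b :: real ^ 'n \<Rightarrow> real ^ 'n. b \<in> borel_measurable borel \<and>
      (\<forall>\<rho> x. 0 < \<rho> \<longrightarrow> \<rho> \<le> \<rho>\<^sub>b \<longrightarrow> Lp_mean_le p\<^sub>b b (ball x \<rho>) (\<alpha> * inverse \<rho>)) \<and>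
      (\<forall>\<epsilon>::real. \<epsilon> > 0 \<longrightarrow> b \<notin> Lp_loc (p\<^sub>b + \<epsilon>))"
    by blast
qed

end
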